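(* For every real number $n > 1$, $$I_n = \int_{0}^{\infty} \frac{\ln x}{x^n+1}\, dx = -\frac{\pi^2}{n^2}\cot\!\Big(\frac{\pi}{n}\Big)\csc\!\Big(\frac{\pi}{n}\Big) = -\frac{d}{dn}\left[\Gamma\Big(1-\frac{1}{n}\Big)\,\Gamma\Big(\frac{1}{n}\Big)\right],$$ where $\frac{d}{dn}$ denotes differentiation with respect to the real variable $n$ on $(1,\infty)$.
   Context: $\Gamma$ denotes the Euler gamma function, $\Gamma(z)=\int_0^\infty t^{z-1}e^{-t}\,dt$ for $\operatorname{Re} z>0$. The parameter $n$ is a real number, not necessarily an integer. *)

theory Defs
  imports "HOL-Analysis.Analysis"
begin

definition csc :: "real \<Rightarrow> real" where
  "csc x = 1 / sin x"

(* The improper integral over (0, \<infinity>), taken as a Lebesgue integral; the value is the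
   intended one only together with integrability of the integrand. *)
definition log_integral :: "real \<Rightarrow> real" where
  "log_integral n = (LBINT x:{0<..}. ln x / (x powr n + 1))"

end

theory Submission imports Defs begin

text \<open>
  The substitution \<open>t = x\<^sup>n / (x\<^sup>n + 1)\<close> turns the Beta integral with parameters \<open>a, 1 - a\<close>
  into a Mellin transform, and Euler's reflection formula evaluates it:
  \<open>\<integral> x\<^sup>s / (x\<^sup>n + 1) dx = pi / (n sin (pi (s + 1) / n))\<close> for \<open>-1 < s < n - 1\<close>.
  Differentiating under the integral sign at \<open>s = 0\<close> produces \<open>ln x\<close>; the difference quotients
  \<open>(x\<^sup>s - 1) / s\<close> are dominated by a multiple of \<open>x\<^sup>2\<^sup>d + x\<^sup>-\<^sup>2\<^sup>d\<close>, which is integrable against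
  \<open>1 / (x\<^sup>n + 1)\<close> for small \<open>d\<close>.
\<close>

text \<open>The complex reflection formula restricted to the real axis. At integers both sides are
  0, since \<open>Gamma\<close> at its poles and division by zero are 0 by convention.\<close>

lemma Gamma_reflection_real: "Gamma (x::real) * Gamma (1 - x) = pi / sin (pi * x)"
proof -
  have "complex_of_real (Gamma x * Gamma (1 - x)) = Gamma (of_real x) * Gamma (1 - of_real x)"
    using Gamma_complex_of_real[of "1 - x"] by (simp add: Gamma_complex_of_real)
  also have "\<dots> = complex_of_real (pi / sin (pi * x))"
    by (simp add: Gamma_reflection_complex flip: sin_of_real)
  finally show ?thesis
    by (simp only: of_real_eq_iff)
qed

lemma bij_betw_powr_div_powr_add_1:
  fixes n :: real
  assumes "n > 0"
  shows "bij_betw (\<lambda>x. x powr n / (x powr n + 1)) {0<..} {0<..<1}"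
proof (rule bij_betw_byWitness[where f' = "\<lambda>t. (t / (1 - t)) powr (1 / n)"])
  have "y / (y + 1) / (1 - y / (y + 1)) = y" if "y > 0" for y :: real
    using that by (simp add: field_simps)
  then have "x powr n / (x powr n + 1) / (1 - x powr n / (x powr n + 1)) = x powr n" if "x > 0" for x :: real
    using that by simp
  then show "\<forall>x\<in>{0<..}. (x powr n / (x powr n + 1) / (1 - x powr n / (x powr n + 1))) powr (1 / n) = x"
    using assms by (simp add: powr_powr)
  show "\<forall>t\<in>{0<..<1}. ((t / (1 - t)) powr (1 / n)) powr n / (((t / (1 - t)) powr (1 / n)) powr n + 1) = t"
    using assms by (auto simp: powr_powr field_simps)
  show "(\<lambda>x. x powr n / (x powr n + 1)) ` {0<..} \<subseteq> {0<..<1}"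
    by (auto simp: field_simps add_pos_pos)
qed (auto simp: field_simps)

text \<open>With exponent \<open>n * a - 1\<close>, substituting \<open>g\<close> gives exactly the
  Beta integrand with parameters \<open>a\<close> and \<open>1 - a\<close>; its integral is
  \<open>Gamma a * Gamma (1 - a)\<close>, as \<open>Gamma 1 = 1\<close>.\<close>

lemma Mellin_Beta:
  fixes n a :: real
  assumes n: "n > 0" and a: "0 < a" "a < 1"
  shows "set_integrable lborel {0<..} (\<lambda>x. x powr (n * a - 1) / (x powr n + 1))"
    and "(LBINT x:{0<..}. x powr (n * a - 1) / (x powr n + 1)) = pi / (n * sin (pi * a))"
proof -
  define f where "f x = x powr (n * a - 1) / (x powr n + 1)" for x
  define g where "g x = x powr n / (x powr n + 1)" for x
  define g' where "g' x = n * x powr (n - 1) / (x powr n + 1)\<^sup>2" for x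
  define B where "B t = t powr (a - 1) * (1 - t) powr ((1 - a) - 1)" for t :: real
  have g: "bij_betw g {0<..} {0<..<1}"
    unfolding g_def using n by (rule bij_betw_powr_div_powr_add_1)
  have B: "(B has_integral (pi / sin (pi * a))) {0..1}"
    using has_integral_Beta_real[of a "1 - a"] a Gamma_reflection_real[of a]
    by (simp add: B_def[abs_def] Beta_def)
  have "set_integrable lborel {0..1} B"
    unfolding B_def using a by (intro integrable_Beta) auto
  then have "set_integrable lborel {0<..<1} B"
    by (rule set_integrable_subset) auto
  \<comment> \<open>\<open>absolutely_integrable_on\<close> refers to the completed measure; for
    Borel measurable functions this agrees with integrability over \<open>lborel\<close>.\<close>
  then have "B absolutely_integrable_on {0<..<1}"
    unfolding set_integrable_def by (subst integrable_completion) auto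
  moreover have "integral {0<..<1} B = pi / sin (pi * a)"
    using B by (simp add: integral_unique has_integral_Icc_iff_Ioo)
  moreover have "(g has_field_derivative g' x) (at x within {0<..})" if "x \<in> {0<..}" for x
  proof -
    have "x powr n + 1 > 0" by (simp add: add_nonneg_pos)
    moreover from this have "x powr n + 1 \<noteq> 0" by simp
    ultimately show ?thesis unfolding g_def g'_def using that
      by (auto intro!: derivative_eq_intros simp: power2_eq_square) (simp add: algebra_simps)
  qed
  ultimately have "(\<lambda>x. \<bar>g' x\<bar> * B (g x)) absolutely_integrable_on {0<..} \<and>
      integral {0<..} (\<lambda>x. \<bar>g' x\<bar> * B (g x)) = pi / sin (pi * a)"
    using has_absolute_integral_change_of_variables_1'[of "{0<..}" g g' B "pi / sin (pi * a)"] g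
    by (auto simp: bij_betw_def)
  \<comment> \<open>With \<open>y = x powr n\<close>, the powers of \<open>y + 1\<close> in
    \<open>B (g x)\<close> combine to a single factor \<open>y + 1\<close>, which cancels one of the
    two in the denominator of \<open>g' x\<close>.\<close>
  moreover have eq: "\<bar>g' x\<bar> * B (g x) = n * f x" if "x \<in> {0<..}" for x
  proof -
    define y where "y = x powr n"
    have x: "x > 0" and y: "y > 0" using that by (auto simp: y_def)
    have "1 - g x = 1 / (y + 1)" using y by (simp add: g_def field_simps flip: y_def)
    moreover have "g x = y / (y + 1)" by (simp add: g_def y_def)
    moreover have "(y + 1) powr a = (y + 1) * (y + 1) powr (a - 1)"
      using y by (simp add: powr_mult_base)
    ultimately have "B (g x) = y powr (a - 1) * (y + 1)"
      using y unfolding B_def by (simp add: powr_divide powr_minus_divide)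
    moreover have "x powr (n * a - 1) = x powr (n - 1) * y powr (a - 1)"
      using x by (simp add: y_def powr_powr algebra_simps flip: powr_add)
    ultimately show ?thesis using y n unfolding f_def g'_def
      by (simp add: power2_eq_square flip: y_def)
  qed
  moreover have "(\<lambda>x. \<bar>g' x\<bar> * B (g x)) absolutely_integrable_on {0<..} \<longleftrightarrow>
      (\<lambda>x. n * f x) absolutely_integrable_on {0<..}"
    by (rule set_integrable_cong[OF refl refl]) (rule eq)
  moreover have "integral {0<..} (\<lambda>x. \<bar>g' x\<bar> * B (g x)) = integral {0<..} (\<lambda>x. n * f x)"
    by (rule integral_cong) (rule eq)
  ultimately have 1: "(\<lambda>x. n * f x) absolutely_integrable_on {0<..}"
    and 2: "integral {0<..} (\<lambda>x. n * f x) = pi / sin (pi * a)"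
    by simp_all
  have "f absolutely_integrable_on {0<..}"
    using 1 n by simp
  then have f: "set_integrable lborel {0<..} f"
    unfolding set_integrable_def by (subst (asm) integrable_completion) (auto simp: f_def)
  then show "set_integrable lborel {0<..} (\<lambda>x. x powr (n * a - 1) / (x powr n + 1))"
    by (simp add: f_def[abs_def])
  have "integral {0<..} f = pi / (n * sin (pi * a))"
  proof -
    have "n * integral {0<..} f = pi / sin (pi * a)" using 2 by simp
    then have "integral {0<..} f = pi / sin (pi * a) / n"
      using n by (metis less_irrefl nonzero_mult_div_cancel_left)
    then show ?thesis by (simp add: mult.commute)
  qed
  then show "(LBINT x:{0<..}. x powr (n * a - 1) / (x powr n + 1)) = pi / (n * sin (pi * a))"
    using set_borel_integral_eq_integral(2)[OF f] by (simp add: f_def[abs_def])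
qed

text \<open>Taking \<open>a = (s + 1) / n\<close> makes the exponent itself the parameter, ready for
  differentiation at \<open>s = 0\<close>; the bounds on \<open>s\<close> say that
  \<open>0 < a < 1\<close>, and together they force \<open>n > 0\<close>.\<close>

lemma Mellin_powr_add_1:
  fixes n s :: real
  assumes "-1 < s" "s < n - 1"
  shows "set_integrable lborel {0<..} (\<lambda>x. x powr s / (x powr n + 1))"
    and "(LBINT x:{0<..}. x powr s / (x powr n + 1)) = pi / (n * sin (pi * (s + 1) / n))"
proof -
  have "n > 0" "0 < (s + 1) / n" "(s + 1) / n < 1" "n * ((s + 1) / n) - 1 = s"
    using assms by auto
  then show "set_integrable lborel {0<..} (\<lambda>x. x powr s / (x powr n + 1))"
    and "(LBINT x:{0<..}. x powr s / (x powr n + 1)) = pi / (n * sin (pi * (s + 1) / n))"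
    using Mellin_Beta[of n "(s + 1) / n"] by simp_all
qed

text \<open>A bound independent of \<open>s\<close>, as dominated convergence requires. With
  \<open>u = ln x\<close>, the quotient is at most
  \<open>\<bar>u\<bar> * exp (d * \<bar>u\<bar>)\<close>, and a second exponential absorbs the
  factor \<open>\<bar>u\<bar>\<close>.\<close>

lemma abs_powr_diff_quotient_le:
  fixes x s d :: real
  assumes x: "x > 0" and s: "0 < s" "s \<le> d"
  shows "\<bar>(x powr s - 1) / s\<bar> \<le> (x powr (2 * d) + x powr (- (2 * d))) / d"
proof -
  define u where "u = ln x"
  \<comment> \<open>This is \<open>1 - v \<le> exp (-v)\<close> multiplied by
    \<open>exp v\<close>.\<close>
  have le: "exp v - 1 \<le> v * exp v" for v :: real
    using exp_ge_add_one_self[of "-v"] by (simp add: exp_minus field_simps)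
  have "\<bar>exp (s * u) - 1\<bar> \<le> s * \<bar>u\<bar> * exp (s * \<bar>u\<bar>)"
  proof (cases "u \<ge> 0")
    case True
    then show ?thesis using le[of "s * u"] s by simp
  next
    case False
    then have "s * u \<le> 0" using s by (simp add: mult_nonneg_nonpos)
    then have "\<bar>exp (s * u) - 1\<bar> = 1 - exp (s * u)" by simp
    also have "\<dots> \<le> s * \<bar>u\<bar> * 1"
      using exp_ge_add_one_self[of "s * u"] False by (simp del: exp_ge_add_one_self)
    also have "\<dots> \<le> s * \<bar>u\<bar> * exp (s * \<bar>u\<bar>)"
      using s by (intro mult_left_mono) auto
    finally show ?thesis .
  qed
  also have "\<dots> \<le> s * (exp (d * \<bar>u\<bar>) / d) * exp (d * \<bar>u\<bar>)"
  proof (intro mult_mono mult_left_mono)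
    show "\<bar>u\<bar> \<le> exp (d * \<bar>u\<bar>) / d"
    proof -
      have "d * \<bar>u\<bar> \<le> exp (d * \<bar>u\<bar>)"
        using exp_ge_add_one_self[of "d * \<bar>u\<bar>"] by linarith
      then show ?thesis using s by (simp add: field_simps)
    qed
  qed (use s in \<open>auto intro!: mult_right_mono\<close>)
  also have "\<dots> = s * (exp (2 * d * \<bar>u\<bar>) / d)"
    by (simp flip: exp_add)
  \<comment> \<open>Depending on the sign of \<open>u\<close>, the left exponential is one of the
    two summands on the right.\<close>
  also have "\<dots> \<le> s * ((exp (2 * d * u) + exp (- (2 * d * u))) / d)"
    using s by (intro mult_left_mono divide_right_mono) (auto simp: abs_if)
  finally have "\<bar>exp (s * u) - 1\<bar> / s \<le> (exp (2 * d * u) + exp (- (2 * d * u))) / d"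
    using s by (simp add: field_simps)
  then show ?thesis
    using x s by (simp add: powr_def u_def)
qed

lemma log_integral_eq:
  fixes n :: real
  assumes n: "n > 1"
  shows "set_integrable lborel {0<..} (\<lambda>x::real. ln x / (x powr n + 1))"
    and "log_integral n = - (pi\<^sup>2 / n\<^sup>2) * cot (pi / n) * csc (pi / n)"
proof -
  \<comment> \<open>This choice puts both exponents \<open>2 * d\<close> and
    \<open>- (2 * d)\<close> strictly between \<open>-1\<close> and \<open>n - 1\<close>, where the
    Mellin integral converges.\<close>
  define d where "d = min 1 (n - 1) / 3"
  have d: "d > 0" "2 * d < 1" "2 * d < n - 1" using n by (auto simp: d_def min_def)
  \<comment> \<open>Dominated convergence is applied along a sequence; its terms are positive, so it
    tends to 0 without reaching it and can be inserted into limits \<open>at 0\<close>.\<close>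
  define s where "s k = d / real (Suc k)" for k
  have s: "0 < s k" "s k \<le> d" "s k < n - 1" for k
  proof -
    show "0 < s k" using d by (simp add: s_def)
    show "s k \<le> d" using d by (simp add: s_def field_simps)
    then show "s k < n - 1" using d by simp
  qed
  have s_lim: "s \<longlonglongrightarrow> 0"
    unfolding s_def by (rule LIMSEQ_Suc) (rule lim_const_over_n)
  then have s_at: "filterlim s (at 0) sequentially"
    using s(1) by (auto simp: filterlim_at less_imp_neq[symmetric])
  define J where "J t = (LBINT x:{0<..}. x powr t / (x powr n + 1))" for t
  define q where "q k x = indicat_real {0<..} x * ((x powr s k - 1) / s k / (x powr n + 1))" for k x
  define f where "f x = indicat_real {0<..} x * (ln x / (x powr n + 1))" for x
  define w where "w x = indicat_real {0<..} x * ((x powr (2 * d) + x powr (- (2 * d))) / d / (x powr n + 1))" for x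
  have [measurable]: "f \<in> borel_measurable lborel" "\<And>k. q k \<in> borel_measurable lborel"
    unfolding f_def q_def by measurable
  have lim: "AE x in lborel. (\<lambda>k. q k x) \<longlonglongrightarrow> f x"
  proof (rule AE_I2)
    fix x :: real
    show "(\<lambda>k. q k x) \<longlonglongrightarrow> f x"
    proof (cases "x > 0")
      case True
      \<comment> \<open>The pointwise limit is the derivative of \<open>x powr t\<close> in the
        exponent at \<open>t = 0\<close>.\<close>
      have "((\<lambda>t. x powr t) has_real_derivative ln x) (at 0)"
        using True by (auto intro!: derivative_eq_intros)
      then have "((\<lambda>t. (x powr t - 1) / t) \<longlongrightarrow> ln x) (at 0)"
        using True by (simp add: DERIV_def)
      then have "(\<lambda>k. (x powr s k - 1) / s k) \<longlonglongrightarrow> ln x"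
        using s_at by (rule filterlim_compose)
      moreover have "x powr n + 1 \<noteq> 0" using powr_ge_zero[of x n] by linarith
      ultimately show ?thesis
        unfolding q_def f_def by (intro tendsto_intros)
    qed (simp add: q_def f_def)
  qed
  have bound: "AE x in lborel. norm (q k x) \<le> w x" for k
  proof (rule AE_I2)
    fix x :: real
    show "norm (q k x) \<le> w x"
    proof (cases "x > 0")
      case True
      have "\<bar>(x powr s k - 1) / s k\<bar> / \<bar>x powr n + 1\<bar> \<le> (x powr (2 * d) + x powr (- (2 * d))) / d / (x powr n + 1)"
      proof -
        have "\<bar>x powr n + 1\<bar> = x powr n + 1" by simp
        then show ?thesis
          using abs_powr_diff_quotient_le[OF True s(1,2)[of k]]
          by (simp only: divide_right_mono add_nonneg_nonneg powr_ge_zero zero_le_one)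
      qed
      then show ?thesis using True by (simp add: q_def w_def abs_divide abs_mult)
    qed (simp add: q_def w_def)
  qed
  have "w = (\<lambda>x. (1 / d) * (indicat_real {0<..} x * (x powr (2 * d) / (x powr n + 1))
          + indicat_real {0<..} x * (x powr (- (2 * d)) / (x powr n + 1))))"
    by (auto simp: w_def fun_eq_iff indicator_def add_divide_distrib mult.commute)
  then have w: "integrable lborel w"
    using Mellin_powr_add_1(1)[of "2 * d" n] Mellin_powr_add_1(1)[of "- (2 * d)" n] d
    by (simp add: set_integrable_def)
  have "integrable lborel f"
    by (rule integrable_dominated_convergence[OF _ _ w lim bound]) measurable
  then show "set_integrable lborel {0<..} (\<lambda>x::real. ln x / (x powr n + 1))"
    by (simp add: set_integrable_def f_def[abs_def])
  \<comment> \<open>The integral of \<open>q k\<close> is a difference quotient of \<open>J\<close>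
    at 0, because \<open>x powr 0 = 1\<close> on the half line.\<close>
  have "integral\<^sup>L lborel (q k) = (J (s k) - J 0) / s k" for k
  proof -
    have 1: "set_integrable lborel {0<..} (\<lambda>x. x powr s k / (x powr n + 1))"
      "set_integrable lborel {0<..} (\<lambda>x. x powr 0 / (x powr n + 1))"
      using s(1,3)[of k] n by (intro Mellin_powr_add_1(1); linarith)+
    have "(J (s k) - J 0) / s k =
       (LBINT x:{0<..}. (x powr s k / (x powr n + 1) - x powr 0 / (x powr n + 1)) / s k)"
      unfolding J_def set_integral_diff(2)[OF 1, symmetric] by simp
    also have "\<dots> = integral\<^sup>L lborel (q k)"
      unfolding set_lebesgue_integral_def
      by (rule Bochner_Integration.integral_cong)
         (auto simp: q_def indicator_def diff_divide_distrib mult.commute)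
    finally show ?thesis by simp
  qed
  then have 1: "(\<lambda>k. (J (s k) - J 0) / s k) \<longlonglongrightarrow> integral\<^sup>L lborel f"
    using integral_dominated_convergence[OF _ _ w lim bound] by simp
  define D where "D = - (pi\<^sup>2 / n\<^sup>2) * cot (pi / n) * csc (pi / n)"
  have sin: "sin (pi / n) > 0" using n by (intro sin_gt_zero) (auto simp: field_simps)
  \<comment> \<open>The same difference quotients are now evaluated through the closed form of
    \<open>J\<close>; uniqueness of limits then identifies the integral of \<open>f\<close> with
    \<open>D\<close>.\<close>
  have "((\<lambda>t. pi / (n * sin (pi * (t + 1) / n))) has_real_derivative D) (at 0)"
    using n sin by (auto intro!: derivative_eq_intros simp: D_def cot_def csc_def power2_eq_square mult_ac)
  then have "((\<lambda>t. (pi / (n * sin (pi * (t + 1) / n)) - J 0) / t) \<longlongrightarrow> D) (at 0)"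
    using Mellin_powr_add_1(2)[of 0 n] n by (simp add: DERIV_def J_def)
  then have "(\<lambda>k. (pi / (n * sin (pi * (s k + 1) / n)) - J 0) / s k) \<longlonglongrightarrow> D"
    using s_at by (rule filterlim_compose)
  moreover have "J (s k) = pi / (n * sin (pi * (s k + 1) / n))" for k
    unfolding J_def using s(1,3)[of k] by (intro Mellin_powr_add_1(2)) auto
  ultimately have "(\<lambda>k. (J (s k) - J 0) / s k) \<longlonglongrightarrow> D"
    by simp
  with 1 have "integral\<^sup>L lborel f = D"
    by (rule LIMSEQ_unique)
  then show "log_integral n = - (pi\<^sup>2 / n\<^sup>2) * cot (pi / n) * csc (pi / n)"
    by (simp add: D_def f_def[abs_def] log_integral_def set_lebesgue_integral_def)
qed

text \<open>Reflection at \<open>1 / m\<close> turns the product into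
  \<open>pi / sin (pi / m)\<close> for every real \<open>m\<close>, including \<open>m = 0\<close>
  by the conventions above, so the two functions of \<open>m\<close> coincide globally and the
  elementary one is differentiated.\<close>

lemma has_real_derivative_Gamma_product:
  fixes n :: real
  assumes "n > 1"
  shows "((\<lambda>m. Gamma (1 - 1 / m) * Gamma (1 / m)) has_real_derivative
           (pi\<^sup>2 / n\<^sup>2) * cot (pi / n) * csc (pi / n)) (at n)"
proof -
  have "sin (pi / n) > 0" using assms by (intro sin_gt_zero) (auto simp: field_simps)
  then have "((\<lambda>m. pi / sin (pi * (1 / m))) has_real_derivative
      (pi\<^sup>2 / n\<^sup>2) * cot (pi / n) * csc (pi / n)) (at n)"
    using assms by (auto intro!: derivative_eq_intros simp: cot_def csc_def power2_eq_square mult_ac)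
  moreover have "Gamma (1 - 1 / m) * Gamma (1 / m) = pi / sin (pi * (1 / m))" for m :: real
    using Gamma_reflection_real[of "1 / m"] by (simp add: mult.commute)
  ultimately show ?thesis by simp
qed

theorem mainTheorem1:
  fixes n :: real
  assumes "n > 1"
  shows "set_integrable lborel {0<..} (\<lambda>x::real. ln x / (x powr n + 1))
    \<and> log_integral n = - (pi\<^sup>2 / n\<^sup>2) * cot (pi / n) * csc (pi / n)
    \<and> (\<lambda>m::real. Gamma (1 - 1 / m) * Gamma (1 / m)) field_differentiable at n
    \<and> log_integral n = - deriv (\<lambda>m::real. Gamma (1 - 1 / m) * Gamma (1 / m)) n"
  using log_integral_eq[OF assms] has_real_derivative_Gamma_product[OF assms]
  by (auto simp: field_differentiable_def DERIV_imp_deriv)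

end
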